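(* Let $a>b>0$ be real numbers, and set $$\mathbf{K}_{+}^{(a,b)}=\mathbf{K}\left(\frac{\sqrt{a}+\sqrt{b}}{\sqrt{2(a+b)}}\right),\qquad \mathbf{K}_{-}^{(a,b)}=\mathbf{K}\left(\frac{\sqrt{a}-\sqrt{b}}{\sqrt{2(a+b)}}\right).$$ Then $$\int_0^\infty\frac{\mathrm{d}p}{\sqrt{p(p^2+a^2)(p^2+b^2)}}=\frac{2}{\sqrt{ab(a+b)}}\,\mathbf{K}_{-}^{(a,b)},$$ $$\int_0^\infty\sqrt{\frac{p}{(p^2+a^2)(p^2+b^2)}}\,\mathrm{d}p=\frac{2}{\sqrt{a+b}}\,\mathbf{K}_{-}^{(a,b)},$$ $$\int_a^\infty\frac{\mathrm{d}p}{\sqrt{p(p^2-a^2)(p^2-b^2)}}=\frac{1}{\sqrt{2ab(a+b)}}\left[\mathbf{K}_{+}^{(a,b)}-\mathbf{K}_{-}^{(a,b)}\right],$$ $$\int_a^\infty\sqrt{\frac{p}{(p^2-a^2)(p^2-b^2)}}\,\mathrm{d}p=\frac{1}{\sqrt{2(a+b)}}\left[\mathbf{K}_{+}^{(a,b)}+\mathbf{K}_{-}^{(a,b)}\right],$$ $$\int_0^b\frac{\mathrm{d}p}{\sqrt{p(p^2-a^2)(p^2-b^2)}}=\frac{1}{\sqrt{2ab(a+b)}}\left[\mathbf{K}_{+}^{(a,b)}+\mathbf{K}_{-}^{(a,b)}\right],$$ $$\int_0^b\sqrt{\frac{p}{(p^2-a^2)(p^2-b^2)}}\,\mathrm{d}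p=\frac{1}{\sqrt{2(a+b)}}\left[\mathbf{K}_{+}^{(a,b)}-\mathbf{K}_{-}^{(a,b)}\right].$$
   Context: For $|k|<1$, $\mathbf{K}(k)=\int_{0}^{1}\frac{\mathrm{d}u}{\sqrt{(1-u^{2})(1-k^{2}u^{2})}}$ is the complete elliptic integral of the first kind with modulus $k$. All integrals are (convergent improper) real integrals. *)

theory Defs
  imports "HOL-Analysis.Analysis"
begin

text \<open>
  Improper integrals are rendered by the Henstock--Kurzweil integral, which on closed intervals,
  bounded or not, agrees with the convergent improper Riemann integral (Hake's theorem).
  At the finitely many singular points the integrands take the value \<open>0\<close> because \<open>x / 0 = 0\<close>;
  this does not affect the integrals.
\<close>

text \<open>Argument: the modulus \<open>k\<close> (not the parameter \<open>k\<^sup>2\<close>); meaningful for \<open>\<bar>k\<bar> < 1\<close>.\<close>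

definition elliptic_K :: "real \<Rightarrow> real" where
  "elliptic_K k = integral {0..1} (\<lambda>u. 1 / sqrt ((1 - u\<^sup>2) * (1 - k\<^sup>2 * u\<^sup>2)))"

definition K_plus :: "real \<Rightarrow> real \<Rightarrow> real" where
  "K_plus a b = elliptic_K ((sqrt a + sqrt b) / sqrt (2 * (a + b)))"

definition K_minus :: "real \<Rightarrow> real \<Rightarrow> real" where
  "K_minus a b = elliptic_K ((sqrt a - sqrt b) / sqrt (2 * (a + b)))"

end

theory Submission
  imports Defs
begin

text \<open>
  Put \<open>c = sqrt (a * b)\<close>. For \<open>w = sqrt p \<mp> c / sqrt p\<close> one has \<open>dw = (p \<plusminus> c) / (2 * p * sqrt p) dp\<close> and
  \<open>w\<^sup>2 \<plusminus> 2 * c = p + c\<^sup>2 / p\<close>, so that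
  \<open>(p \<plusminus> c) dp / sqrt (p * (p\<^sup>2 - a\<^sup>2) * (p\<^sup>2 - b\<^sup>2))\<close> becomes
  \<open>2 dw / sqrt ((w\<^sup>2 - \<alpha>\<^sup>2) * (w\<^sup>2 + \<beta>\<^sup>2))\<close> with \<open>{\<alpha>, \<beta>} = {sqrt a - sqrt b, sqrt a + sqrt b}\<close>; the
  substitution \<open>w = \<alpha> / cos \<phi>\<close> turns its integral over \<open>w > \<alpha>\<close> into a complete elliptic integral. Sum and
  difference of the two signs give the integrals over \<open>p > a\<close>. With plus signs in the radicand, the
  upper choice leads to \<open>2 dw / sqrt (w^4 + 4 * c * w\<^sup>2 + (a + b)\<^sup>2)\<close> over the whole line, where
  \<open>w = sqrt (a + b) * tan \<theta>\<close> applies. Finally \<open>p \<mapsto> a * b / p\<close> exchanges the two kinds of integrands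
  and maps \<open>(0, b)\<close> onto \<open>(a, \<infinity>)\<close>. All integrands are nonnegative, hence absolutely integrable as soon
  as they are integrable, which makes every substitution legitimate at the singular end points.
\<close>

section \<open>Change of variables for nonnegative integrands\<close>

text \<open>For nonnegative functions integrability and absolute integrability coincide, so the
  substitution theorem for absolutely integrable functions applies. The equivalence transfers
  existence of the integral together with its value, in either direction; with open intervals as
  \<open>S\<close> and \<open>T\<close> no limit at singular end points has to be taken. The
  separate \<open>h\<close> allows the pulled-back integrand to be given in simplified form.\<close>

lemma has_integral_change_of_variables_nonneg:
  fixes f g :: "real \<Rightarrow> real"
  assumes "S \<in> sets lebesgue"
    and "\<And>x. x \<in> S \<Longrightarrow> (g has_field_derivative g' x) (at x)"
    and "bij_betw g S T"
    and "\<And>y. y \<in> T \<Longrightarrow> 0 \<le> f y"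
    and "\<And>x. x \<in> S \<Longrightarrow> h x = \<bar>g' x\<bar> * f (g x)"
  shows "(h has_integral I) S \<longleftrightarrow> (f has_integral I) T"
proof -
  have T: "g ` S = T" and inj: "inj_on g S"
    using assms(3) by (auto simp: bij_betw_def)
  have "(h has_integral I) S \<longleftrightarrow> ((\<lambda>x. \<bar>g' x\<bar> * f (g x)) has_integral I) S"
    using assms(5) by (intro has_integral_cong) auto
  also have "\<dots> \<longleftrightarrow> (\<lambda>x. \<bar>g' x\<bar> * f (g x)) absolutely_integrable_on S \<and>
      integral S (\<lambda>x. \<bar>g' x\<bar> * f (g x)) = I"
    using assms(4) T by (subst absolutely_integrable_on_iff_nonneg) (auto simp: has_integral_iff)
  also have "\<dots> \<longleftrightarrow> f absolutely_integrable_on g ` S \<and> integral (g ` S) f = I"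
    using assms(1,2) inj
    by (intro has_absolute_integral_change_of_variables_1') (auto intro: has_field_derivative_at_within)
  also have "\<dots> \<longleftrightarrow> (f has_integral I) T"
    using assms(4) T by (subst absolutely_integrable_on_iff_nonneg) (auto simp: has_integral_iff)
  finally show ?thesis .
qed

section \<open>Normal forms of the complete elliptic integral\<close>

lemma elliptic_radicand_pos:
  fixes k :: real
  assumes "\<bar>k\<bar> < 1"
  shows "0 < 1 - k\<^sup>2 * (sin \<phi>)\<^sup>2"
proof -
  have "k\<^sup>2 * (sin \<phi>)\<^sup>2 \<le> k\<^sup>2 * 1"
    by (intro mult_left_mono) (auto simp: abs_square_le_1)
  also have "\<dots> < 1"
    using assms by (simp add: abs_square_less_1)
  finally show ?thesis by simp
qed

text \<open>Substitution \<open>u = sin \<phi>\<close> between the open intervals. The trigonometric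
  integrand is continuous on the compact interval, so existence of the integral comes from that side
  and passes to the singular algebraic integrand.\<close>

lemma has_integral_elliptic_K_trig:
  assumes k: "\<bar>k\<bar> < 1"
  shows "((\<lambda>\<phi>. 1 / sqrt (1 - k\<^sup>2 * (sin \<phi>)\<^sup>2)) has_integral elliptic_K k) {0..pi/2}"
proof -
  let ?h = "\<lambda>\<phi>. 1 / sqrt (1 - k\<^sup>2 * (sin \<phi>)\<^sup>2)"
  let ?f = "\<lambda>u. 1 / sqrt ((1 - u\<^sup>2) * (1 - k\<^sup>2 * u\<^sup>2))"
  have "continuous_on {0..pi/2} ?h"
    using elliptic_radicand_pos[OF k] by (intro continuous_intros) (auto simp: less_le)
  then have "?h integrable_on {0..pi/2}"
    by (rule integrable_continuous_real)
  then have I: "(?h has_integral integral {0..pi/2} ?h) {0..pi/2}"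
    by (rule integrable_integral)
  have "bij_betw sin {0<..<pi/2} {0<..<1}"
  proof (rule bij_betw_byWitness[where f' = arcsin])
    show "sin ` {0<..<pi/2} \<subseteq> {0<..<1}"
      using sin_gt_zero sin_monotone_2pi[of _ "pi/2"] by (fastforce simp: pi_gt_zero)
    show "arcsin ` {0<..<1} \<subseteq> {0<..<pi/2}"
      using arcsin_less_mono[of 0] arcsin_less_mono[of _ 1] by fastforce
  qed (auto simp: arcsin_sin)
  moreover have "?h \<phi> = \<bar>cos \<phi>\<bar> * ?f (sin \<phi>)" if "\<phi> \<in> {0<..<pi/2}" for \<phi>
  proof -
    have "cos \<phi> > 0"
      using that by (intro cos_gt_zero_pi) auto
    then show ?thesis
      by (simp add: real_sqrt_mult flip: cos_squared_eq)
  qed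
  moreover have "0 \<le> ?f u" if "u \<in> {0<..<1}" for u
  proof -
    have u: "u\<^sup>2 \<le> 1" using that by (auto simp: abs_square_le_1)
    have "k\<^sup>2 * u\<^sup>2 \<le> 1 * 1"
      using k u by (intro mult_mono) (auto simp: abs_square_le_1)
    with u show ?thesis by auto
  qed
  ultimately have "(?h has_integral integral {0..pi/2} ?h) {0<..<pi/2} \<longleftrightarrow>
      (?f has_integral integral {0..pi/2} ?h) {0<..<1}"
    by (intro has_integral_change_of_variables_nonneg[where g = sin and g' = cos])
       (auto intro: DERIV_sin)
  then have "(?f has_integral integral {0..pi/2} ?h) {0..1}"
    using I by (simp add: has_integral_Icc_iff_Ioo)
  then have "elliptic_K k = integral {0..pi/2} ?h"
    unfolding elliptic_K_def by (rule integral_unique)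
  with I show ?thesis by simp
qed

text \<open>The square of \<open>sin (2 * \<theta>)\<close> is invariant under
  \<open>\<theta> \<mapsto> pi/2 - \<theta>\<close> and
  \<open>\<theta> \<mapsto> - \<theta>\<close>, so four quarters contribute
  \<open>elliptic_K k / 2\<close> each. This is the form that a tangent substitution on the whole
  line produces.\<close>

lemma has_integral_elliptic_K_full_period:
  assumes k: "\<bar>k\<bar> < 1"
  shows "((\<lambda>\<theta>. 1 / sqrt (1 - k\<^sup>2 * (sin (2 * \<theta>))\<^sup>2)) has_integral 2 * elliptic_K k) {-(pi/2)..pi/2}"
proof -
  let ?f = "\<lambda>\<theta>. 1 / sqrt (1 - k\<^sup>2 * (sin (2 * \<theta>))\<^sup>2)"
  have nonneg: "0 \<le> ?f \<theta>" for \<theta>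
    using elliptic_radicand_pos[OF k, of "2 * \<theta>"] by simp
  have 1: "(?f has_integral elliptic_K k / 2) {0..pi/4}"
    using has_integral_affinity'[of _ "elliptic_K k" 0 "pi/2" 2 0]
      has_integral_elliptic_K_trig[OF k] by (simp add: field_simps)
  have bij: "bij_betw (\<lambda>\<theta>. pi/2 - \<theta>) {pi/4..pi/2} {0..pi/4}"
    by (rule bij_betw_byWitness[where f' = "\<lambda>\<theta>. pi/2 - \<theta>"]) auto
  have "(?f has_integral elliptic_K k / 2) {pi/4..pi/2} \<longleftrightarrow>
      (?f has_integral elliptic_K k / 2) {0..pi/4}"
    by (rule has_integral_change_of_variables_nonneg[OF _ _ bij, where g' = "\<lambda>_. -1"])
       (use nonneg in \<open>auto intro!: derivative_eq_intros simp: right_diff_distrib sin_diff\<close>)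
  with 1 have 2: "(?f has_integral elliptic_K k / 2) {pi/4..pi/2}"
    by simp
  have 3: "(?f has_integral elliptic_K k) {0..pi/2}"
    using has_integral_combine[OF _ _ 1 2] by simp
  have 4: "(?f has_integral elliptic_K k) {-(pi/2)..0}"
    using has_integral_reflect_lemma_real[OF 3] by simp
  show ?thesis
    using has_integral_combine[OF _ _ 4 3] by simp
qed

text \<open>For \<open>w = \<alpha> / cos \<phi>\<close> the two factors become
  \<open>\<alpha>\<^sup>2 * (sin \<phi>)\<^sup>2\<close> and
  \<open>r\<^sup>2 - \<beta>\<^sup>2 * (sin \<phi>)\<^sup>2\<close>, each over
  \<open>(cos \<phi>)\<^sup>2\<close>; this explains the modulus \<open>\<beta> / r\<close> and the
  factor \<open>1 / r\<close>.\<close>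

lemma has_integral_elliptic_K_two_real_roots:
  fixes \<alpha> \<beta> :: real
  assumes "\<alpha> > 0" "\<beta> > 0"
  defines "r \<equiv> sqrt (\<alpha>\<^sup>2 + \<beta>\<^sup>2)"
  shows "((\<lambda>w. 1 / sqrt ((w\<^sup>2 - \<alpha>\<^sup>2) * (w\<^sup>2 + \<beta>\<^sup>2))) has_integral elliptic_K (\<beta> / r) / r) {\<alpha><..}"
proof -
  let ?f = "\<lambda>w. 1 / sqrt ((w\<^sup>2 - \<alpha>\<^sup>2) * (w\<^sup>2 + \<beta>\<^sup>2))"
  let ?h = "\<lambda>\<phi>. 1 / sqrt (1 - (\<beta> / r)\<^sup>2 * (sin \<phi>)\<^sup>2) / r"
  have r: "r > 0" "r\<^sup>2 = \<alpha>\<^sup>2 + \<beta>\<^sup>2" "\<beta> < r"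
    using assms by (auto simp: r_def add_pos_pos real_less_rsqrt)
  have k: "\<bar>\<beta> / r\<bar> < 1"
    using r \<open>\<beta> > 0\<close> by simp
  have h: "(?h has_integral elliptic_K (\<beta> / r) / r) {0<..<pi/2}"
    using has_integral_divide[OF has_integral_elliptic_K_trig[OF k]]
    by (simp only: has_integral_Icc_iff_Ioo)
  have bij: "bij_betw (\<lambda>\<phi>. \<alpha> / cos \<phi>) {0<..<pi/2} {\<alpha><..}"
  proof (rule bij_betw_byWitness[where f' = "\<lambda>w. arccos (\<alpha> / w)"])
    show "\<forall>\<phi>\<in>{0<..<pi/2}. arccos (\<alpha> / (\<alpha> / cos \<phi>)) = \<phi>"
      using \<open>\<alpha> > 0\<close> by (auto simp: arccos_cos)
    show "\<forall>w\<in>{\<alpha><..}. \<alpha> / cos (arccos (\<alpha> / w)) = w"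
      using \<open>\<alpha> > 0\<close> by (auto simp: cos_arccos_abs)
    show "(\<lambda>\<phi>. \<alpha> / cos \<phi>) ` {0<..<pi/2} \<subseteq> {\<alpha><..}"
    proof (clarsimp)
      fix \<phi> :: real assume "0 < \<phi>" "\<phi> * 2 < pi"
      then have "0 < cos \<phi>" "cos \<phi> < 1"
        using cos_gt_zero_pi[of \<phi>] cos_monotone_0_pi[of 0 \<phi>] by auto
      then show "\<alpha> < \<alpha> / cos \<phi>"
        using \<open>\<alpha> > 0\<close> by (simp add: field_simps)
    qed
    show "(\<lambda>w. arccos (\<alpha> / w)) ` {\<alpha><..} \<subseteq> {0<..<pi/2}"
    proof clarify
      fix w assume "\<alpha> < w"
      then have "0 < \<alpha> / w" "\<alpha> / w < 1"
        using \<open>\<alpha> > 0\<close> by auto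
      then show "arccos (\<alpha> / w) \<in> {0<..<pi/2}"
        using arccos_less_arccos[of 0 "\<alpha> / w"] arccos_less_arccos[of "\<alpha> / w" 1] by auto
    qed
  qed
  have "(?h has_integral elliptic_K (\<beta> / r) / r) {0<..<pi/2} \<longleftrightarrow>
      (?f has_integral elliptic_K (\<beta> / r) / r) {\<alpha><..}"
  proof (rule has_integral_change_of_variables_nonneg
      [OF _ _ bij, where g' = "\<lambda>\<phi>. \<alpha> * sin \<phi> / (cos \<phi>)\<^sup>2"])
    fix \<phi> assume \<phi>: "\<phi> \<in> {0<..<pi/2}"
    then have c: "cos \<phi> > 0" and s: "sin \<phi> > 0"
      by (auto intro: cos_gt_zero_pi sin_gt_zero)
    show "((\<lambda>\<phi>. \<alpha> / cos \<phi>) has_real_derivative \<alpha> * sin \<phi> / (cos \<phi>)\<^sup>2) (at \<phi>)"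
      using c by (auto intro!: derivative_eq_intros simp: power2_eq_square field_simps)
    have "((\<alpha> / cos \<phi>)\<^sup>2 - \<alpha>\<^sup>2) * ((\<alpha> / cos \<phi>)\<^sup>2 + \<beta>\<^sup>2) =
        (\<alpha>\<^sup>2 * (1 - (cos \<phi>)\<^sup>2)) * (\<alpha>\<^sup>2 + \<beta>\<^sup>2 * (cos \<phi>)\<^sup>2) / ((cos \<phi>)\<^sup>2)\<^sup>2"
      using c by (simp add: field_simps power2_eq_square)
    also have "\<dots> = (\<alpha> * sin \<phi> * r / (cos \<phi>)\<^sup>2)\<^sup>2 * (1 - (\<beta> / r)\<^sup>2 * (sin \<phi>)\<^sup>2)"
      using c r unfolding power_divide power_mult_distrib r(2)
      by (simp add: sin_squared_eq divide_simps r(2)) (simp add: algebra_simps)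
    finally have "sqrt (((\<alpha> / cos \<phi>)\<^sup>2 - \<alpha>\<^sup>2) * ((\<alpha> / cos \<phi>)\<^sup>2 + \<beta>\<^sup>2)) =
        \<alpha> * sin \<phi> * r / (cos \<phi>)\<^sup>2 * sqrt (1 - (\<beta> / r)\<^sup>2 * (sin \<phi>)\<^sup>2)"
      using c s r \<open>\<alpha> > 0\<close> by (simp add: real_sqrt_mult)
    then show "?h \<phi> = \<bar>\<alpha> * sin \<phi> / (cos \<phi>)\<^sup>2\<bar> * ?f (\<alpha> / cos \<phi>)"
      using c s r \<open>\<alpha> > 0\<close> by simp
  next
    fix w assume "w \<in> {\<alpha><..}"
    then have "\<alpha>\<^sup>2 \<le> w\<^sup>2" using \<open>\<alpha> > 0\<close> by (intro power_mono) auto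
    then show "0 \<le> ?f w" by simp
  qed auto
  with h show ?thesis by simp
qed

text \<open>The middle coefficient is written through \<open>k\<close> so that
  \<open>w = sqrt s * tan \<theta>\<close> makes the quartic, up to the factor
  \<open>s\<^sup>2 / (cos \<theta>)^4\<close>, equal to the square of
  \<open>(sin \<theta>)\<^sup>2 + (cos \<theta>)\<^sup>2\<close> minus
  \<open>k\<^sup>2 * (sin (2 * \<theta>))\<^sup>2\<close>.\<close>

lemma has_integral_elliptic_K_complex_roots:
  assumes k: "\<bar>k\<bar> < 1" and "s > 0"
  shows "((\<lambda>w. 1 / sqrt (w^4 + 2 * (1 - 2 * k\<^sup>2) * s * w\<^sup>2 + s\<^sup>2)) has_integral
    2 / sqrt s * elliptic_K k) UNIV"
proof -
  let ?f = "\<lambda>w. 1 / sqrt (w^4 + 2 * (1 - 2 * k\<^sup>2) * s * w\<^sup>2 + s\<^sup>2)"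
  let ?h = "\<lambda>\<theta>. 1 / sqrt (1 - k\<^sup>2 * (sin (2 * \<theta>))\<^sup>2) / sqrt s"
  have h: "(?h has_integral 2 / sqrt s * elliptic_K k) {-(pi/2)<..<pi/2}"
    using has_integral_divide[OF has_integral_elliptic_K_full_period[OF k], of "sqrt s"]
    by (simp add: has_integral_Icc_iff_Ioo)
  have bij: "bij_betw (\<lambda>\<theta>. sqrt s * tan \<theta>) {-(pi/2)<..<pi/2} UNIV"
    by (rule bij_betw_byWitness[where f' = "\<lambda>w. arctan (w / sqrt s)"])
       (use \<open>s > 0\<close> arctan_lbound arctan_ubound in \<open>auto simp: arctan_tan tan_arctan\<close>)
  have "(?h has_integral 2 / sqrt s * elliptic_K k) {-(pi/2)<..<pi/2} \<longleftrightarrow>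
      (?f has_integral 2 / sqrt s * elliptic_K k) UNIV"
  proof (rule has_integral_change_of_variables_nonneg
      [OF _ _ bij, where g' = "\<lambda>\<theta>. sqrt s / (cos \<theta>)\<^sup>2"])
    fix \<theta> assume "\<theta> \<in> {-(pi/2)<..<pi/2}"
    then have c: "cos \<theta> > 0"
      by (auto intro: cos_gt_zero_pi)
    show "((\<lambda>\<theta>. sqrt s * tan \<theta>) has_real_derivative sqrt s / (cos \<theta>)\<^sup>2) (at \<theta>)"
      using c by (auto intro!: derivative_eq_intros simp: field_simps)
    have "(sin \<theta>)^4 + 2 * (1 - 2 * k\<^sup>2) * (sin \<theta>)\<^sup>2 * (cos \<theta>)\<^sup>2 + (cos \<theta>)^4 =
        ((sin \<theta>)\<^sup>2 + (cos \<theta>)\<^sup>2)\<^sup>2 - k\<^sup>2 * (2 * sin \<theta> * cos \<theta>)\<^sup>2"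
      by algebra
    then have trig: "(sin \<theta>)^4 + 2 * (1 - 2 * k\<^sup>2) * (sin \<theta>)\<^sup>2 * (cos \<theta>)\<^sup>2 + (cos \<theta>)^4 =
        1 - k\<^sup>2 * (sin (2 * \<theta>))\<^sup>2"
      by (simp add: sin_double)
    have "(sqrt s * tan \<theta>)^4 + 2 * (1 - 2 * k\<^sup>2) * s * (sqrt s * tan \<theta>)\<^sup>2 + s\<^sup>2 =
        s\<^sup>2 * ((sin \<theta>)^4 + 2 * (1 - 2 * k\<^sup>2) * (sin \<theta>)\<^sup>2 * (cos \<theta>)\<^sup>2 + (cos \<theta>)^4) / (cos \<theta>)^4"
    proof -
      have fourth: "x^4 = (x\<^sup>2)\<^sup>2" for x :: real by simp
      have tan: "(sqrt s * tan \<theta>)\<^sup>2 = s * (sin \<theta>)\<^sup>2 / (cos \<theta>)\<^sup>2"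
        using \<open>s > 0\<close> by (simp add: tan_def power_mult_distrib power_divide)
      have "s\<^sup>2 * (x\<^sup>2 + m * x * y + y\<^sup>2) / y\<^sup>2 = (s * x / y)\<^sup>2 + m * s * (s * x / y) + s\<^sup>2"
        if "y > 0" for x y m
        using that by (simp add: field_simps power2_eq_square)
      from this[of "(cos \<theta>)\<^sup>2" "(sin \<theta>)\<^sup>2" "2 * (1 - 2 * k\<^sup>2)", symmetric] show ?thesis
        unfolding fourth tan using c by simp
    qed
    also have "\<dots> = (s / (cos \<theta>)\<^sup>2)\<^sup>2 * (1 - k\<^sup>2 * (sin (2 * \<theta>))\<^sup>2)"
      unfolding trig by (simp add: power_divide)
    finally have "sqrt ((sqrt s * tan \<theta>)^4 + 2 * (1 - 2 * k\<^sup>2) * s * (sqrt s * tan \<theta>)\<^sup>2 + s\<^sup>2) =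
        s / (cos \<theta>)\<^sup>2 * sqrt (1 - k\<^sup>2 * (sin (2 * \<theta>))\<^sup>2)"
      using c \<open>s > 0\<close> by (simp add: real_sqrt_mult)
    moreover have "1 / (x * sqrt s) = sqrt s / (s * x)" for x
      using \<open>s > 0\<close> by (simp add: divide_simps)
    ultimately show "?h \<theta> = \<bar>sqrt s / (cos \<theta>)\<^sup>2\<bar> * ?f (sqrt s * tan \<theta>)"
      using c \<open>s > 0\<close> by simp
  next
    fix w :: real
    have "k\<^sup>2 \<le> 1" using k by (simp add: abs_square_le_1)
    have "0 \<le> (w\<^sup>2 - s)\<^sup>2 + 4 * (1 - k\<^sup>2) * s * w\<^sup>2"
      using \<open>k\<^sup>2 \<le> 1\<close> \<open>s > 0\<close> by (intro add_nonneg_nonneg mult_nonneg_nonneg) auto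
    also have "\<dots> = w^4 + 2 * (1 - 2 * k\<^sup>2) * s * w\<^sup>2 + s\<^sup>2"
      by algebra
    finally show "0 \<le> ?f w" by simp
  qed auto
  with h show ?thesis by simp
qed

section \<open>Bijectivity of the substitutions \<open>w = sqrt p - c / sqrt p\<close> and
  \<open>w = sqrt p + c / sqrt p\<close>\<close>

lemma bij_betw_sqrt_greaterThan: "A \<ge> 0 \<Longrightarrow> bij_betw sqrt {A\<^sup>2<..} {A<..}"
proof (rule bij_betw_byWitness[where f' = "\<lambda>x. x\<^sup>2"])
  assume "A \<ge> 0"
  then show "sqrt ` {A\<^sup>2<..} \<subseteq> {A<..}"
    by (auto intro: real_less_rsqrt)
  show "\<forall>p\<in>{A\<^sup>2<..}. (sqrt p)\<^sup>2 = p"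
    by (auto intro: order_trans[of 0 "A\<^sup>2"] less_imp_le)
qed (auto intro: power_strict_mono)

text \<open>The map is strictly increasing on the positive axis, and its inverse sends
  \<open>w\<close> to the positive root of \<open>x\<^sup>2 - w * x - c\<close>.\<close>

lemma bij_betw_diff_inverse:
  fixes c A :: real
  assumes "c > 0" "A > 0"
  shows "bij_betw (\<lambda>x. x - c / x) {A<..} {A - c / A<..}"
    and "bij_betw (\<lambda>x. x - c / x) {0<..} UNIV"
proof -
  let ?g = "\<lambda>x. x - c / x"
  let ?f = "\<lambda>w. (w + sqrt (w\<^sup>2 + 4 * c)) / 2"
  have mono: "?g x < ?g y" if "0 < x" "x < y" for x y
    using divide_strict_left_mono[of x y c] that \<open>c > 0\<close> by simp
  have fpos: "?f w > 0" for w
  proof -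
    have "sqrt (w\<^sup>2) < sqrt (w\<^sup>2 + 4 * c)" using \<open>c > 0\<close> by (intro real_sqrt_less_mono) auto
    then show ?thesis by simp
  qed
  have gf: "?g (?f w) = w" for w
  proof -
    have "(sqrt (w\<^sup>2 + 4 * c))\<^sup>2 = w\<^sup>2 + 4 * c" using \<open>c > 0\<close> by simp
    then have "?f w * ?f w - c = w * ?f w" by (simp add: field_simps power2_eq_square)
    then show ?thesis using fpos[of w] by (simp only: divide_simps) simp
  qed
  \<comment> \<open>A right inverse of a strictly increasing map, with values in its domain, is also
    a left inverse.\<close>
  have fg: "?f (?g x) = x" if "x > 0" for x
    using mono[of x "?f (?g x)"] mono[of "?f (?g x)" x] fpos[of "?g x"] gf[of "?g x"] that
    by (metis linorder_less_linear order_less_irrefl)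
  show "bij_betw ?g {0<..} UNIV"
    by (rule bij_betw_byWitness[where f' = ?f]) (use fg gf fpos in auto)
  show "bij_betw ?g {A<..} {A - c / A<..}"
  proof (rule bij_betw_byWitness[where f' = ?f])
    show "?f ` {A - c / A<..} \<subseteq> {A<..}"
    proof (rule image_subsetI)
      fix w assume "w \<in> {A - c / A<..}"
      then have w: "A - c / A < w" by simp
      show "?f w \<in> {A<..}"
      proof (rule ccontr)
        assume "?f w \<notin> {A<..}"
        then have "?f w \<le> A" by simp
        with mono[of "?f w" A] fpos[of w] have "?g (?f w) \<le> ?g A"
          by (cases "?f w = A") auto
        with w show False unfolding gf by simp
      qed
    qed
  qed (use fg gf mono \<open>A > 0\<close> in auto)
qed

text \<open>The map decreases up to \<open>sqrt c\<close> and increases from there on, whence the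
  condition \<open>c \<le> A\<^sup>2\<close>. The inverse picks the larger root of
  \<open>x\<^sup>2 - w * x + c\<close>.\<close>

lemma bij_betw_add_inverse:
  fixes c A :: real
  assumes "c > 0" "A > 0" "c \<le> A\<^sup>2"
  shows "bij_betw (\<lambda>x. x + c / x) {A<..} {A + c / A<..}"
proof -
  let ?g = "\<lambda>x. x + c / x"
  let ?f = "\<lambda>w. (w + sqrt (w\<^sup>2 - 4 * c)) / 2"
  have mono: "?g x < ?g y" if "A \<le> x" "x < y" for x y
  proof -
    have "A * A < x * y" using that \<open>A > 0\<close> by (intro mult_le_less_imp_less) auto
    with \<open>c \<le> A\<^sup>2\<close> have "c < x * y" by (simp add: power2_eq_square)
    then have "0 < (y - x) * (x * y - c) / (x * y)" using that \<open>A > 0\<close> by (intro divide_pos_pos mult_pos_pos) auto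
    also have "\<dots> = ?g y - ?g x" using that \<open>A > 0\<close> by (simp add: field_simps)
    finally show ?thesis by simp
  qed
  have f: "A < ?f w" "?g (?f w) = w" if w: "A + c / A < w" for w
  proof -
    have "c / A \<le> A" using assms by (simp add: field_simps power2_eq_square)
    \<comment> \<open>At the end point \<open>w = A + c / A\<close> the discriminant
      \<open>w\<^sup>2 - 4 * c\<close> is the square of \<open>A - c / A\<close>; beyond it the
      larger root therefore exceeds \<open>A\<close>.\<close>
    have eq: "(A + c / A)\<^sup>2 = (A - c / A)\<^sup>2 + 4 * c" using \<open>A > 0\<close> by (simp add: field_simps power2_eq_square)
    have "(A + c / A)\<^sup>2 < w\<^sup>2" using w assms by (intro power_strict_mono) auto
    then have D: "(A - c / A)\<^sup>2 < w\<^sup>2 - 4 * c" unfolding eq by simp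
    then have "A - c / A < sqrt (w\<^sup>2 - 4 * c)"
      by (rule real_less_rsqrt)
    with w show "A < ?f w" by simp
    have "(sqrt (w\<^sup>2 - 4 * c))\<^sup>2 = w\<^sup>2 - 4 * c"
      using D zero_le_power2[of "A - c / A"] by (intro real_sqrt_pow2) linarith
    then have "?f w * ?f w + c = w * ?f w" by (simp add: field_simps power2_eq_square)
    then show "?g (?f w) = w"
      using \<open>A < ?f w\<close> \<open>A > 0\<close> by (simp only: divide_simps) simp
  qed
  have fg: "?f (?g x) = x" if "x > A" for x
    using mono[of A x] mono[of x "?f (?g x)"] mono[of "?f (?g x)" x] f[of "?g x"] that
    by (metis less_imp_le linorder_less_linear order_less_irrefl order_refl)
  show ?thesis
    by (rule bij_betw_byWitness[where f' = ?f]) (use fg f mono in auto)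
qed

text \<open>The sign of \<open>c\<close> is left free, so that \<open>- c\<close> covers the other
  substitution.\<close>

lemma has_real_derivative_sqrt_add_inverse:
  fixes c p :: real
  assumes "p > 0"
  shows "((\<lambda>p. sqrt p + c / sqrt p) has_real_derivative (p - c) / (2 * p * sqrt p)) (at p)"
  using assms by (auto intro!: derivative_eq_intros simp: field_simps)

text \<open>With \<open>q = sqrt p\<close> the first factor is \<open>dw/dp\<close>, and
  \<open>r\<close> is the square root of the radicand in \<open>w\<close>; the product takes the
  shape of the integrand in \<open>p\<close>.\<close>

lemma divide_two_mult_two:
  fixes p q r x :: real
  shows "x / (2 * p * q) * (2 / r) = x / (q * (p * r))"
  by simp

section \<open>Integrals with numerator \<open>p + sqrt (a * b)\<close> or
  \<open>p - sqrt (a * b)\<close>\<close>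

context
  fixes a b :: real
  assumes ab: "a > b" "b > 0"
begin

lemma sqrt_params:
  shows "0 < sqrt a" "0 < sqrt b" "sqrt b < sqrt a" "sqrt (a * b) = sqrt a * sqrt b"
    "(sqrt a)\<^sup>2 = a" "(sqrt b)\<^sup>2 = b" "sqrt (a * b) / sqrt a = sqrt b"
    "(sqrt (a * b))\<^sup>2 = a * b" "0 < sqrt (a * b)"
  using ab by (auto simp: real_sqrt_mult power_mult_distrib)

text \<open>For \<open>w = sqrt p - c / sqrt p\<close> one has
  \<open>w\<^sup>2 - \<alpha>\<^sup>2 = (p - a) * (p - b) / p\<close> and
  \<open>w\<^sup>2 + \<beta>\<^sup>2 = (p + a) * (p + b) / p\<close>. Since
  \<open>\<alpha>\<^sup>2 + \<beta>\<^sup>2 = 2 * (a + b)\<close>, the modulus is that of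
  \<open>K_plus\<close>.\<close>

lemma has_integral_outer_plus:
  "((\<lambda>p. (p + sqrt (a * b)) / sqrt (p * ((p\<^sup>2 - a\<^sup>2) * (p\<^sup>2 - b\<^sup>2)))) has_integral
      2 / sqrt (2 * (a + b)) * K_plus a b) {a<..}" (is "(?h has_integral _) _")
proof -
  define \<alpha> \<beta> c where "\<alpha> = sqrt a - sqrt b" and "\<beta> = sqrt a + sqrt b" and "c = sqrt (a * b)"
  let ?f = "\<lambda>w. 2 / sqrt ((w\<^sup>2 - \<alpha>\<^sup>2) * (w\<^sup>2 + \<beta>\<^sup>2))"
  have "\<alpha> > 0" "\<beta> > 0" using sqrt_params(1-3) by (auto simp: \<alpha>_def \<beta>_def intro: add_pos_pos)
  have sq: "\<alpha>\<^sup>2 = a + b - 2 * c" "\<beta>\<^sup>2 = a + b + 2 * c"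
    using sqrt_params(4-6) by (auto simp: \<alpha>_def \<beta>_def c_def power2_sum power2_diff)
  then have sum: "\<alpha>\<^sup>2 + \<beta>\<^sup>2 = 2 * (a + b)" by simp
  have "((\<lambda>w. 2 * (1 / sqrt ((w\<^sup>2 - \<alpha>\<^sup>2) * (w\<^sup>2 + \<beta>\<^sup>2)))) has_integral
      2 * (elliptic_K (\<beta> / sqrt (\<alpha>\<^sup>2 + \<beta>\<^sup>2)) / sqrt (\<alpha>\<^sup>2 + \<beta>\<^sup>2))) {\<alpha><..}"
    using \<open>\<alpha> > 0\<close> \<open>\<beta> > 0\<close>
    by (intro has_integral_mult_right has_integral_elliptic_K_two_real_roots)
  then have f: "(?f has_integral 2 / sqrt (2 * (a + b)) * K_plus a b) {\<alpha><..}"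
    unfolding sum by (simp add: K_plus_def \<beta>_def)
  have c: "c > 0" using sqrt_params by (simp add: c_def)
  have "bij_betw ((\<lambda>x. x - c / x) \<circ> sqrt) {(sqrt a)\<^sup>2<..} {sqrt a - c / sqrt a<..}"
    using sqrt_params bij_betw_diff_inverse(1)[of c "sqrt a"]
    by (intro bij_betw_trans[OF bij_betw_sqrt_greaterThan]) (auto simp: c_def)
  \<comment> \<open>The end point \<open>sqrt a - c / sqrt a\<close> is \<open>\<alpha>\<close>
    because \<open>c / sqrt a = sqrt b\<close>.\<close>
  then have bij: "bij_betw (\<lambda>p. sqrt p - c / sqrt p) {a<..} {\<alpha><..}"
    using sqrt_params unfolding c_def \<alpha>_def o_def by simp
  have "(?h has_integral 2 / sqrt (2 * (a + b)) * K_plus a b) {a<..} \<longleftrightarrow>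
      (?f has_integral 2 / sqrt (2 * (a + b)) * K_plus a b) {\<alpha><..}"
  proof (rule has_integral_change_of_variables_nonneg
      [OF _ _ bij, where g' = "\<lambda>p. (p + c) / (2 * p * sqrt p)"])
    fix p assume "p \<in> {a<..}"
    then have p: "p > 0" "p > a" using ab by auto
    show "((\<lambda>p. sqrt p - c / sqrt p) has_real_derivative (p + c) / (2 * p * sqrt p)) (at p)"
      using has_real_derivative_sqrt_add_inverse[OF \<open>p > 0\<close>, of "- c"] by simp
    have w: "(sqrt p - c / sqrt p)\<^sup>2 = p + c\<^sup>2 / p - 2 * c"
      using p by (simp add: power2_diff power_divide)
    have c2: "c\<^sup>2 = a * b" using sqrt_params(8) by (simp add: c_def)
    have "p\<^sup>2 * (((sqrt p - c / sqrt p)\<^sup>2 - \<alpha>\<^sup>2) * ((sqrt p - c / sqrt p)\<^sup>2 + \<beta>\<^sup>2)) =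
        (p\<^sup>2 + a * b)\<^sup>2 - p\<^sup>2 * (a + b)\<^sup>2"
      using p unfolding w sq c2
      by (simp add: divide_simps) (simp add: algebra_simps power2_eq_square)
    also have "\<dots> = (p\<^sup>2 - a\<^sup>2) * (p\<^sup>2 - b\<^sup>2)" by algebra
    finally have eq: "sqrt ((p\<^sup>2 - a\<^sup>2) * (p\<^sup>2 - b\<^sup>2)) =
        p * sqrt (((sqrt p - c / sqrt p)\<^sup>2 - \<alpha>\<^sup>2) * ((sqrt p - c / sqrt p)\<^sup>2 + \<beta>\<^sup>2))"
      using p by (metis real_sqrt_mult real_sqrt_abs abs_of_pos)
    have "\<bar>(p + c) / (2 * p * sqrt p)\<bar> = (p + c) / (2 * p * sqrt p)"
      using p c by simp
    then show "(p + sqrt (a * b)) / sqrt (p * ((p\<^sup>2 - a\<^sup>2) * (p\<^sup>2 - b\<^sup>2))) =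
        \<bar>(p + c) / (2 * p * sqrt p)\<bar> * ?f (sqrt p - c / sqrt p)"
      by (simp only: real_sqrt_mult[of p] eq divide_two_mult_two flip: c_def)
  next
    fix w assume "w \<in> {\<alpha><..}"
    then have "\<alpha>\<^sup>2 \<le> w\<^sup>2" using \<open>\<alpha> > 0\<close> by (intro power_mono) auto
    then show "0 \<le> ?f w" by simp
  qed auto
  with f show ?thesis by simp
qed

text \<open>The same factorisations hold for \<open>w = sqrt p + c / sqrt p\<close> once the values
  of \<open>\<alpha>\<close> and \<open>\<beta>\<close> are exchanged, which turns the modulus into
  that of \<open>K_minus\<close>.\<close>

lemma has_integral_outer_minus:
  "((\<lambda>p. (p - sqrt (a * b)) / sqrt (p * ((p\<^sup>2 - a\<^sup>2) * (p\<^sup>2 - b\<^sup>2)))) has_integral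
      2 / sqrt (2 * (a + b)) * K_minus a b) {a<..}" (is "(?h has_integral _) _")
proof -
  define \<alpha> \<beta> c where "\<alpha> = sqrt a + sqrt b" and "\<beta> = sqrt a - sqrt b" and "c = sqrt (a * b)"
  let ?f = "\<lambda>w. 2 / sqrt ((w\<^sup>2 - \<alpha>\<^sup>2) * (w\<^sup>2 + \<beta>\<^sup>2))"
  have "\<alpha> > 0" "\<beta> > 0" using sqrt_params(1-3) by (auto simp: \<alpha>_def \<beta>_def intro: add_pos_pos)
  have sq: "\<alpha>\<^sup>2 = a + b + 2 * c" "\<beta>\<^sup>2 = a + b - 2 * c"
    using sqrt_params(4-6) by (auto simp: \<alpha>_def \<beta>_def c_def power2_sum power2_diff)
  then have sum: "\<alpha>\<^sup>2 + \<beta>\<^sup>2 = 2 * (a + b)" by simp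
  have "((\<lambda>w. 2 * (1 / sqrt ((w\<^sup>2 - \<alpha>\<^sup>2) * (w\<^sup>2 + \<beta>\<^sup>2)))) has_integral
      2 * (elliptic_K (\<beta> / sqrt (\<alpha>\<^sup>2 + \<beta>\<^sup>2)) / sqrt (\<alpha>\<^sup>2 + \<beta>\<^sup>2))) {\<alpha><..}"
    using \<open>\<alpha> > 0\<close> \<open>\<beta> > 0\<close>
    by (intro has_integral_mult_right has_integral_elliptic_K_two_real_roots)
  then have f: "(?f has_integral 2 / sqrt (2 * (a + b)) * K_minus a b) {\<alpha><..}"
    unfolding sum by (simp add: K_minus_def \<beta>_def)
  \<comment> \<open>The bound \<open>c < a\<close> serves twice: as
    \<open>c \<le> (sqrt a)\<^sup>2\<close> for the bijection, and to keep \<open>p - c\<close>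
    positive for \<open>p > a\<close>.\<close>
  have c: "0 < c" "c < a"
    using sqrt_params ab real_sqrt_less_mono[of "a * b" "a * a"] by (auto simp: c_def)
  have "bij_betw ((\<lambda>x. x + c / x) \<circ> sqrt) {(sqrt a)\<^sup>2<..} {sqrt a + c / sqrt a<..}"
    using sqrt_params c bij_betw_add_inverse[of c "sqrt a"]
    by (intro bij_betw_trans[OF bij_betw_sqrt_greaterThan]) auto
  then have bij: "bij_betw (\<lambda>p. sqrt p + c / sqrt p) {a<..} {\<alpha><..}"
    using sqrt_params unfolding c_def \<alpha>_def o_def by simp
  have "(?h has_integral 2 / sqrt (2 * (a + b)) * K_minus a b) {a<..} \<longleftrightarrow>
      (?f has_integral 2 / sqrt (2 * (a + b)) * K_minus a b) {\<alpha><..}"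
  proof (rule has_integral_change_of_variables_nonneg
      [OF _ _ bij, where g' = "\<lambda>p. (p - c) / (2 * p * sqrt p)"])
    fix p assume "p \<in> {a<..}"
    then have p: "p > 0" "p > a" "p > c" using ab c by auto
    show "((\<lambda>p. sqrt p + c / sqrt p) has_real_derivative (p - c) / (2 * p * sqrt p)) (at p)"
      using has_real_derivative_sqrt_add_inverse[OF \<open>p > 0\<close>, of c] by simp
    have w: "(sqrt p + c / sqrt p)\<^sup>2 = p + c\<^sup>2 / p + 2 * c"
      using p by (simp add: power2_sum power_divide)
    have c2: "c\<^sup>2 = a * b" using sqrt_params(8) by (simp add: c_def)
    have "p\<^sup>2 * (((sqrt p + c / sqrt p)\<^sup>2 - \<alpha>\<^sup>2) * ((sqrt p + c / sqrt p)\<^sup>2 + \<beta>\<^sup>2)) =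
        (p\<^sup>2 + a * b)\<^sup>2 - p\<^sup>2 * (a + b)\<^sup>2"
      using p unfolding w sq c2
      by (simp add: divide_simps) (simp add: algebra_simps power2_eq_square)
    also have "\<dots> = (p\<^sup>2 - a\<^sup>2) * (p\<^sup>2 - b\<^sup>2)" by algebra
    finally have eq: "sqrt ((p\<^sup>2 - a\<^sup>2) * (p\<^sup>2 - b\<^sup>2)) =
        p * sqrt (((sqrt p + c / sqrt p)\<^sup>2 - \<alpha>\<^sup>2) * ((sqrt p + c / sqrt p)\<^sup>2 + \<beta>\<^sup>2))"
      using p by (metis real_sqrt_mult real_sqrt_abs abs_of_pos)
    have "\<bar>(p - c) / (2 * p * sqrt p)\<bar> = (p - c) / (2 * p * sqrt p)"
      using p c by simp
    then show "(p - sqrt (a * b)) / sqrt (p * ((p\<^sup>2 - a\<^sup>2) * (p\<^sup>2 - b\<^sup>2))) =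
        \<bar>(p - c) / (2 * p * sqrt p)\<bar> * ?f (sqrt p + c / sqrt p)"
      by (simp only: real_sqrt_mult[of p] eq divide_two_mult_two flip: c_def)
  next
    fix w assume "w \<in> {\<alpha><..}"
    then have "\<alpha>\<^sup>2 \<le> w\<^sup>2" using \<open>\<alpha> > 0\<close> by (intro power_mono) auto
    then show "0 \<le> ?f w" by simp
  qed auto
  with f show ?thesis by simp
qed

text \<open>Here \<open>p + c\<^sup>2 / p = w\<^sup>2 + 2 * c\<close>, and
  \<open>(p\<^sup>2 + a\<^sup>2) * (p\<^sup>2 + b\<^sup>2)\<close> is \<open>p\<^sup>2\<close> times
  a quartic in \<open>w\<close> without real roots. The \<open>K_minus\<close> modulus satisfies
  \<open>1 - 2 * k\<^sup>2 = 2 * c / (a + b)\<close>, as the normal form with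
  \<open>s = a + b\<close> demands.\<close>

lemma has_integral_half_line_plus:
  "((\<lambda>p. (p + sqrt (a * b)) / sqrt (p * ((p\<^sup>2 + a\<^sup>2) * (p\<^sup>2 + b\<^sup>2)))) has_integral
      4 / sqrt (a + b) * K_minus a b) {0<..}" (is "(?h has_integral _) _")
proof -
  define k c where "k = (sqrt a - sqrt b) / sqrt (2 * (a + b))" and "c = sqrt (a * b)"
  let ?f = "\<lambda>w. 2 / sqrt (w^4 + 4 * c * w\<^sup>2 + (a + b)\<^sup>2)"
  have c: "c > 0" using sqrt_params by (simp add: c_def)
  have k2: "k\<^sup>2 = (a + b - 2 * c) / (2 * (a + b))"
    using sqrt_params(4-6) ab by (simp add: k_def c_def power_divide power2_diff)
  also have "\<dots> < 1" using ab c by (simp add: field_simps)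
  finally have k: "\<bar>k\<bar> < 1" by (simp add: abs_square_less_1)
  have ks: "2 * (1 - 2 * k\<^sup>2) * (a + b) = 4 * c"
    using ab unfolding k2 by (simp add: field_simps)
  have "((\<lambda>w. 2 * (1 / sqrt (w^4 + 4 * c * w\<^sup>2 + (a + b)\<^sup>2))) has_integral
      2 * (2 / sqrt (a + b) * elliptic_K k)) UNIV"
    using has_integral_elliptic_K_complex_roots[OF k, of "a + b"] ab unfolding ks
    by (intro has_integral_mult_right) auto
  then have f: "(?f has_integral 4 / sqrt (a + b) * K_minus a b) UNIV"
    by (simp add: K_minus_def k_def)
  \<comment> \<open>The lower bound is written as a square to fit
    \<open>bij_betw_sqrt_greaterThan\<close>.\<close>
  have "bij_betw ((\<lambda>x. x - c / x) \<circ> sqrt) {0\<^sup>2<..} UNIV"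
    using c bij_betw_diff_inverse(2)[of c 1]
    by (intro bij_betw_trans[OF bij_betw_sqrt_greaterThan]) auto
  then have bij: "bij_betw (\<lambda>p. sqrt p - c / sqrt p) {0<..} UNIV"
    by (simp add: o_def)
  have "(?h has_integral 4 / sqrt (a + b) * K_minus a b) {0<..} \<longleftrightarrow>
      (?f has_integral 4 / sqrt (a + b) * K_minus a b) UNIV"
  proof (rule has_integral_change_of_variables_nonneg
      [OF _ _ bij, where g' = "\<lambda>p. (p + c) / (2 * p * sqrt p)"])
    fix p :: real assume "p \<in> {0<..}"
    then have p: "p > 0" by auto
    show "((\<lambda>p. sqrt p - c / sqrt p) has_real_derivative (p + c) / (2 * p * sqrt p)) (at p)"
      using has_real_derivative_sqrt_add_inverse[OF \<open>p > 0\<close>, of "- c"] by simp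
    define w where "w = sqrt p - c / sqrt p"
    have w: "w\<^sup>2 = p + c\<^sup>2 / p - 2 * c"
      using p by (simp add: w_def power2_diff power_divide)
    have c2: "c\<^sup>2 = a * b" using sqrt_params by (simp add: c_def)
    have "p\<^sup>2 * (w^4 + 4 * c * w\<^sup>2 + (a + b)\<^sup>2) = (p * (w\<^sup>2 + 2 * c))\<^sup>2 + p\<^sup>2 * ((a + b)\<^sup>2 - 4 * c\<^sup>2)"
      by algebra
    also have "\<dots> = (p\<^sup>2 + a * b)\<^sup>2 + p\<^sup>2 * (a - b)\<^sup>2"
      using p unfolding w c2
      by (simp add: divide_simps) (simp add: algebra_simps power2_eq_square)
    also have "\<dots> = (p\<^sup>2 + a\<^sup>2) * (p\<^sup>2 + b\<^sup>2)" by algebra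
    finally have eq: "sqrt ((p\<^sup>2 + a\<^sup>2) * (p\<^sup>2 + b\<^sup>2)) = p * sqrt (w^4 + 4 * c * w\<^sup>2 + (a + b)\<^sup>2)"
      using p by (metis real_sqrt_mult real_sqrt_abs abs_of_pos)
    have "\<bar>(p + c) / (2 * p * sqrt p)\<bar> = (p + c) / (2 * p * sqrt p)"
      using p c by simp
    then show "(p + sqrt (a * b)) / sqrt (p * ((p\<^sup>2 + a\<^sup>2) * (p\<^sup>2 + b\<^sup>2))) =
        \<bar>(p + c) / (2 * p * sqrt p)\<bar> * ?f (sqrt p - c / sqrt p)"
      by (simp only: real_sqrt_mult[of p] eq divide_two_mult_two flip: c_def w_def)
  next
    fix w :: real
    show "0 \<le> ?f w" using c by simp
  qed auto
  with f show ?thesis by simp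
qed

end

section \<open>Inversion, and combination of the two numerators\<close>

text \<open>Under \<open>p = c / q\<close> the scaling law of \<open>D\<close> turns
  \<open>dp / sqrt (p * D p)\<close> into \<open>sqrt (q / D q) dq / sqrt c\<close>, up to
  orientation, and similarly with the two integrands exchanged. In the application this
  \<open>c\<close> is the product \<open>a * b\<close>, not its square root.\<close>

lemma has_integral_inversion:
  fixes c :: real and D :: "real \<Rightarrow> real"
  assumes "c > 0" "S \<in> sets lebesgue" "S \<subseteq> {0<..}" "T \<subseteq> {0<..}"
    and bij: "bij_betw (\<lambda>q. c / q) S T"
    and D: "\<And>q. q \<in> S \<Longrightarrow> D (c / q) = c\<^sup>2 * D q / q^4"
    and nonneg: "\<And>p. p \<in> T \<Longrightarrow> 0 \<le> D p"
  shows "((\<lambda>q. sqrt (q / D q)) has_integral sqrt c * I) S \<longleftrightarrow>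
      ((\<lambda>p. 1 / sqrt (p * D p)) has_integral I) T" (is ?inv)
    and "((\<lambda>q. 1 / sqrt (q * D q)) has_integral I / sqrt c) S \<longleftrightarrow>
      ((\<lambda>p. sqrt (p / D p)) has_integral I) T" (is ?inv')
proof -
  have der: "((\<lambda>q. c / q) has_real_derivative - (c / q\<^sup>2)) (at q)" if "q \<in> S" for q
    using that assms(3) by (auto intro!: derivative_eq_intros simp: power2_eq_square)
  have pos: "0 \<le> 1 / sqrt (p * D p)" "0 \<le> sqrt (p / D p)" if "p \<in> T" for p
    using that nonneg[OF that] assms(4) by (auto intro!: divide_nonneg_nonneg)
  have sq: "sqrt (D (c / q)) = c * sqrt (D q) / q\<^sup>2" if "q \<in> S" for q
  proof -
    have "sqrt (q^4) = q\<^sup>2" by (rule real_sqrt_unique) auto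
    then show ?thesis
      using D[OF that] \<open>c > 0\<close> by (simp add: real_sqrt_mult real_sqrt_divide)
  qed
  have q: "q > 0" "sqrt q * sqrt q = q" if "q \<in> S" for q using that assms(3) by auto
  have c: "sqrt c * sqrt c = c" using \<open>c > 0\<close> by simp
  have "((\<lambda>q. 1 / sqrt c * sqrt (q / D q)) has_integral I) S \<longleftrightarrow>
      ((\<lambda>p. 1 / sqrt (p * D p)) has_integral I) T"
    by (rule has_integral_change_of_variables_nonneg[OF assms(2) der bij pos(1)])
       (use q sq c \<open>c > 0\<close> in \<open>auto simp: real_sqrt_mult real_sqrt_divide field_simps\<close>)
  then show ?inv
    using \<open>c > 0\<close> by (subst (asm) has_integral_mult_right_iff) (auto simp: mult.commute)
  have "((\<lambda>q. sqrt c * (1 / sqrt (q * D q))) has_integral I) S \<longleftrightarrow>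
      ((\<lambda>p. sqrt (p / D p)) has_integral I) T"
    by (rule has_integral_change_of_variables_nonneg[OF assms(2) der bij pos(2)])
       (use q sq c \<open>c > 0\<close> in \<open>auto simp: real_sqrt_mult real_sqrt_divide field_simps\<close>)
  then show ?inv'
    using \<open>c > 0\<close> by (subst (asm) has_integral_mult_right_iff) auto
qed

lemma has_integral_spike_Ici:
  fixes f :: "real \<Rightarrow> real"
  assumes "(f has_integral I) {a<..}"
  shows "(f has_integral I) {a..}"
proof -
  have "(f has_integral I) {a..} \<longleftrightarrow> (f has_integral I) {a<..}"
  proof (rule has_integral_spike_set_eq)
    show "negligible {x \<in> {a..} - {a<..}. f x \<noteq> 0}"
      by (rule negligible_subset[of "{a}"]) auto
    show "negligible {x \<in> {a<..} - {a..}. f x \<noteq> 0}"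
      by (rule negligible_subset[of "{a}"]) auto
  qed
  with assms show ?thesis by simp
qed

lemma sqrt_divide_eq:
  fixes p x :: real
  assumes "p > 0"
  shows "sqrt (p / x) = p / sqrt (p * x)"
proof -
  have "p / sqrt (p * x) = p / sqrt p / sqrt x"
    by (simp add: real_sqrt_mult)
  also have "\<dots> = sqrt (p / x)"
    using assms by (simp only: real_div_sqrt less_imp_le real_sqrt_divide)
  finally show ?thesis ..
qed

text \<open>Half the sum of the numerators is \<open>p\<close>, half their difference is
  \<open>c\<close>, and \<open>p / sqrt (p * D p)\<close> equals \<open>sqrt (p / D p)\<close> for
  \<open>p > 0\<close>.\<close>

lemma has_integral_mult_sqrt:
  fixes D :: "real \<Rightarrow> real"
  assumes "c > 0" "S \<subseteq> {0<..}"
    and P: "((\<lambda>p. (p + c) / sqrt (p * D p)) has_integral P) S"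
    and M: "((\<lambda>p. (p - c) / sqrt (p * D p)) has_integral M) S"
  shows "((\<lambda>p. 1 / sqrt (p * D p)) has_integral (P - M) / (2 * c)) S"
    and "((\<lambda>p. sqrt (p / D p)) has_integral (P + M) / 2) S"
proof -
  show "((\<lambda>p. 1 / sqrt (p * D p)) has_integral (P - M) / (2 * c)) S"
    by (rule has_integral_eq[OF _ has_integral_divide[OF has_integral_diff[OF P M], of "2 * c"]])
       (use \<open>c > 0\<close> in \<open>simp flip: diff_divide_distrib\<close>)
  show "((\<lambda>p. sqrt (p / D p)) has_integral (P + M) / 2) S"
    by (intro has_integral_eq[OF _ has_integral_divide[OF has_integral_add[OF P M], of 2]])
       (use \<open>S \<subseteq> {0<..}\<close> in \<open>auto simp: sqrt_divide_eq simp flip: add_divide_distrib\<close>)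
qed

section \<open>The six integrals\<close>

theorem theorem2p1:
  fixes a b :: real
  assumes "a > b" and "b > 0"
  shows
    "((\<lambda>p. 1 / sqrt (p * (p\<^sup>2 + a\<^sup>2) * (p\<^sup>2 + b\<^sup>2))) has_integral
        2 / sqrt (a * b * (a + b)) * K_minus a b) {0..} \<and>
     ((\<lambda>p. sqrt (p / ((p\<^sup>2 + a\<^sup>2) * (p\<^sup>2 + b\<^sup>2)))) has_integral
        2 / sqrt (a + b) * K_minus a b) {0..} \<and>
     ((\<lambda>p. 1 / sqrt (p * (p\<^sup>2 - a\<^sup>2) * (p\<^sup>2 - b\<^sup>2))) has_integral
        1 / sqrt (2 * a * b * (a + b)) * (K_plus a b - K_minus a b)) {a..} \<and>
     ((\<lambda>p. sqrt (p / ((p\<^sup>2 - a\<^sup>2) * (p\<^sup>2 - b\<^sup>2)))) has_integral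
        1 / sqrt (2 * (a + b)) * (K_plus a b + K_minus a b)) {a..} \<and>
     ((\<lambda>p. 1 / sqrt (p * (p\<^sup>2 - a\<^sup>2) * (p\<^sup>2 - b\<^sup>2))) has_integral
        1 / sqrt (2 * a * b * (a + b)) * (K_plus a b + K_minus a b)) {0..b} \<and>
     ((\<lambda>p. sqrt (p / ((p\<^sup>2 - a\<^sup>2) * (p\<^sup>2 - b\<^sup>2)))) has_integral
        1 / sqrt (2 * (a + b)) * (K_plus a b - K_minus a b)) {0..b}"
proof -
  define c s where "c = sqrt (a * b)" and "s = sqrt (2 * (a + b))"
  define D where "D = (\<lambda>p. (p\<^sup>2 - a\<^sup>2) * (p\<^sup>2 - b\<^sup>2))"
  define E where "E = (\<lambda>p. (p\<^sup>2 + a\<^sup>2) * (p\<^sup>2 + b\<^sup>2))"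
  note ab = assms
  have c: "c > 0" using ab by (simp add: c_def)
  have s: "s > 0" using ab by (simp add: s_def)
  have factors: "sqrt (2 * a * b * (a + b)) = c * s" "sqrt (a * b * (a + b)) = c * sqrt (a + b)"
    unfolding c_def s_def real_sqrt_mult by simp_all

  have sub: "{a<..} \<subseteq> {0<..}" using ab by auto
  have P: "((\<lambda>p. (p + c) / sqrt (p * D p)) has_integral 2 / s * K_plus a b) {a<..}"
    using has_integral_outer_plus[OF ab] unfolding c_def s_def D_def .
  have M: "((\<lambda>p. (p - c) / sqrt (p * D p)) has_integral 2 / s * K_minus a b) {a<..}"
    using has_integral_outer_minus[OF ab] unfolding c_def s_def D_def .
  have val: "(2 / s * K_plus a b - 2 / s * K_minus a b) / (2 * c) =
      1 / (c * s) * (K_plus a b - K_minus a b)"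
    using c s by (simp add: field_simps)
  have outer: "((\<lambda>p. 1 / sqrt (p * D p)) has_integral
      1 / (c * s) * (K_plus a b - K_minus a b)) {a<..}"
    using has_integral_mult_sqrt(1)[OF c sub P M] unfolding val .
  have val: "(2 / s * K_plus a b + 2 / s * K_minus a b) / 2 = 1 / s * (K_plus a b + K_minus a b)"
    using s by (simp add: field_simps)
  have outer': "((\<lambda>p. sqrt (p / D p)) has_integral 1 / s * (K_plus a b + K_minus a b)) {a<..}"
    using has_integral_mult_sqrt(2)[OF c sub P M] unfolding val .

  \<comment> \<open>One identity serves both radicands, with \<open>e = -1\<close> for
    \<open>D\<close> and \<open>e = 1\<close> for \<open>E\<close>, at \<open>x = a\<^sup>2\<close>,
    \<open>y = b\<^sup>2\<close>, \<open>z = q\<^sup>2\<close>: inversion swaps the two factors up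
    to scaling.\<close>
  have inv: "(x * y / z + e * x) * (x * y / z + e * y) = x * y * ((z + e * x) * (z + e * y)) / (z * z)"
    if "z \<noteq> 0" "e * e = 1" for x y z e :: real
  proof -
    have "x * y / z + e * x = e * x * (z + e * y) / z" "x * y / z + e * y = e * y * (z + e * x) / z"
      using that by (simp_all add: divide_simps) (simp_all add: algebra_simps)
    then show ?thesis
      using that by (simp add: ac_simps)
  qed
  have sq: "(a * b / q)\<^sup>2 = a\<^sup>2 * b\<^sup>2 / q\<^sup>2" "(a * b)\<^sup>2 = a\<^sup>2 * b\<^sup>2" "q^4 = q\<^sup>2 * q\<^sup>2" for q
    by (simp_all add: power_mult_distrib power_divide flip: power_add)
  have D_inv: "D (a * b / q) = (a * b)\<^sup>2 * D q / q^4" if "q > 0" for q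
    unfolding D_def sq using inv[of "q\<^sup>2" "-1" "a\<^sup>2" "b\<^sup>2"] that by simp
  have E_inv: "E (a * b / q) = (a * b)\<^sup>2 * E q / q^4" if "q > 0" for q
    unfolding E_def sq using inv[of "q\<^sup>2" 1 "a\<^sup>2" "b\<^sup>2"] that by simp
  have bij: "bij_betw (\<lambda>q. a * b / q) {0<..<b} {a<..}"
    by (rule bij_betw_byWitness[where f' = "\<lambda>q. a * b / q"]) (use ab in \<open>auto simp: field_simps\<close>)
  have bij': "bij_betw (\<lambda>q. a * b / q) {0<..} {0<..}"
    by (rule bij_betw_byWitness[where f' = "\<lambda>q. a * b / q"]) (use ab in \<open>auto simp: field_simps\<close>)

  have prod: "a * b > 0" using ab by simp
  have sub': "{0<..<b} \<subseteq> {0<..}" by auto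
  have D_nonneg: "0 \<le> D p" if "p \<in> {a<..}" for p
    using that ab unfolding D_def by (intro mult_nonneg_nonneg) (auto intro: power_mono)
  \<comment> \<open>Inversion exchanges the integrands, so each integral over \<open>(0, b)\<close>
    inherits the sign in its bracket from the other integrand over
    \<open>(a, \<infinity>)\<close>.\<close>
  have "((\<lambda>p. 1 / sqrt (p * D p)) has_integral 1 / s * (K_plus a b + K_minus a b) / c) {0<..<b}"
    unfolding c_def
    by (rule iffD2[OF has_integral_inversion(2)[OF prod _ sub' sub bij]])
       (use outer' in \<open>simp_all add: D_inv D_nonneg\<close>)
  then have inner: "((\<lambda>p. 1 / sqrt (p * D p)) has_integral
      1 / (c * s) * (K_plus a b + K_minus a b)) {0<..<b}"
    by (simp add: ac_simps)
  have "((\<lambda>p. sqrt (p / D p)) has_integral c * (1 / (c * s) * (K_plus a b - K_minus a b))) {0<..<b}"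
    unfolding c_def
    by (rule iffD2[OF has_integral_inversion(1)[OF prod _ sub' sub bij]])
       (use outer in \<open>simp_all add: D_inv D_nonneg c_def\<close>)
  then have inner': "((\<lambda>p. sqrt (p / D p)) has_integral 1 / s * (K_plus a b - K_minus a b)) {0<..<b}"
    using c by simp

  let ?F = "\<lambda>p. 1 / sqrt (p * E p)" and ?G = "\<lambda>p. sqrt (p / E p)"
  have E_pos: "E p > 0" for p
    using ab unfolding E_def by (intro mult_pos_pos add_nonneg_pos) auto
  have H: "((\<lambda>p. (p + c) / sqrt (p * E p)) has_integral 4 / sqrt (a + b) * K_minus a b) {0<..}"
    using has_integral_half_line_plus[OF ab] unfolding c_def E_def .
  \<comment> \<open>On the half line only the numerator \<open>p + c\<close> has been integrated.
    Existence of the integral of \<open>?F\<close> follows by comparison, since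
    \<open>1 \<le> (p + c) / c\<close>.\<close>
  have "?F absolutely_integrable_on {0<..}"
  proof (rule measurable_bounded_by_integrable_imp_absolutely_integrable)
    have "continuous_on {0<..} E" unfolding E_def by (intro continuous_intros)
    moreover have "E p \<noteq> 0" for p using E_pos[of p] by simp
    ultimately have "continuous_on {0<..} ?F" by (intro continuous_intros) auto
    then show "?F \<in> borel_measurable (lebesgue_on {0<..})"
      by (rule continuous_imp_measurable_on_sets_lebesgue) auto
    show "(\<lambda>p. (p + c) / sqrt (p * E p) / c) integrable_on {0<..}"
      using has_integral_divide[OF H] by (rule has_integral_integrable)
    fix p :: real assume "p \<in> {0<..}"
    then show "norm (?F p) \<le> (p + c) / sqrt (p * E p) / c"
      using c E_pos[of p] by (simp add: divide_simps)
  qed auto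
  then obtain I where F: "(?F has_integral I) {0<..}"
    using set_lebesgue_integral_eq_integral(1) by blast
  \<comment> \<open>Inversion maps the half line to itself, so the integral of \<open>?G\<close> is
    \<open>c * I\<close>. The integral for \<open>p + c\<close> is then \<open>2 * c * I\<close>,
    which determines \<open>I\<close>.\<close>
  have G_int: "(?G has_integral c * I) {0<..}"
    unfolding c_def
    by (rule iffD2[OF has_integral_inversion(1)[OF prod _ _ _ bij']])
       (use F in \<open>simp_all add: E_inv E_pos less_imp_le\<close>)
  have "((\<lambda>p. ?G p + c * ?F p) has_integral c * I + c * I) {0<..}"
    by (intro has_integral_add has_integral_mult_right F G_int)
  then have "((\<lambda>p. (p + c) / sqrt (p * E p)) has_integral c * I + c * I) {0<..}"
    by (rule has_integral_eq[rotated]) (auto simp: sqrt_divide_eq add_divide_distrib)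
  then have "c * I + c * I = 4 / sqrt (a + b) * K_minus a b"
    using H by (rule has_integral_unique)
  moreover have "4 / sqrt (a + b) * K_minus a b = 2 * (2 / sqrt (a + b) * K_minus a b)"
    by simp
  ultimately have cI: "c * I = 2 / sqrt (a + b) * K_minus a b"
    by linarith
  have "I = c * I / c" using c by simp
  then have I: "I = 2 / (c * sqrt (a + b)) * K_minus a b"
    unfolding cI by simp

  have radicands: "p * (p\<^sup>2 + a\<^sup>2) * (p\<^sup>2 + b\<^sup>2) = p * E p" "p * (p\<^sup>2 - a\<^sup>2) * (p\<^sup>2 - b\<^sup>2) = p * D p"
    "(p\<^sup>2 + a\<^sup>2) * (p\<^sup>2 + b\<^sup>2) = E p" "(p\<^sup>2 - a\<^sup>2) * (p\<^sup>2 - b\<^sup>2) = D p" for p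
    by (simp_all only: D_def E_def mult.assoc)
  show ?thesis
    unfolding radicands factors has_integral_Icc_iff_Ioo s_def[symmetric]
    using F[unfolded I] G_int[unfolded cI] outer outer' inner inner'
    by (intro conjI has_integral_spike_Ici)
qed

end
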